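(* Consider the sets $$d_{1}=\Big\{a=(a_{k})\in \omega:\sup_{K\in\mathcal{F}}\sum_{n=0}^\infty\Big|\sum_{k\in K}\frac{f_{n+1}^{2}}{f_{k}f_{k+1}}a_{n}\Big|<\infty\Big\},$$ $$d_{2}=\Big\{a=(a_{k})\in\omega:\sup_{n\in\mathbb{N}}\sum_{k=0}^{n}\Big|\sum_{j=k}^{n}\frac{f_{j+1}^{2}}{f_{k}f_{k+1}}a_{j}\Big|<\infty\Big\},$$ $$d_{3}=\Big\{ a=(a_{k})\in \omega:\lim_{n\to\infty}\sum_{j=k}^{n}\frac{f_{j+1}^{2}}{f_{k}f_{k+1}}a_{j}\text{ exists for each }k\in\mathbb{N}\Big\},$$ $$d_{4}=\Big\{a=(a_{k})\in\omega:\lim_{n\to\infty}\sum_{k=0}^{n}\sum_{j=k}^{n}\frac{f_{j+1}^{2}}{f_{k}f_{k+1}}a_{j} \text{ exists}\Big\}.$$ Then the following statements hold. (a) $\{c_{0}(\widehat{F})\}^{\alpha}=\{c(\widehat{F})\}^{\alpha}=d_{1}$. (b) $\{c_{0}(\widehat{F})\}^{\beta}=d_{2}\cap d_{3}$ and $\{c(\widehat{F})\}^{\beta}=d_{2}\cap d_{3}\cap d_{4}$. (c) $\{c_{0}(\widehat{F})\}^{\gamma}=\{c(\widehat{F})\}^{\gamma}=d_{2}$.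
   Context: Let $\mathbb{N}=\{0,1,2,\dots\}$, let $\mathcal{F}$ be the collection of all finite subsets of $\mathbb{N}$, and let $\omega$ be the vector space of all real sequences $x=(x_k)_{k\in\mathbb{N}}$. The Fibonacci numbers are defined by $f_0=f_1=1$ and $f_n=f_{n-1}+f_{n-2}$ for $n\ge 2$. For $x\in\omega$ the $\widehat{F}$-transform $\widehat{F}x=(\widehat{F}_n(x))_{n\in\mathbb{N}}$ is defined by $\widehat{F}_0(x)=x_0$ and $\widehat{F}_n(x)=\frac{f_n}{f_{n+1}}x_n-\frac{f_{n+1}}{f_n}x_{n-1}$ for $n\ge1$. Let $c_0$ and $c$ be the spaces of null and of convergent sequences, and put $c_0(\widehat{F})=\{x\in\omega:\widehat{F}x\in c_0\}$ and $c(\widehat{F})=\{x\in\omega:\widehat{F}x\in c\}$. Let $\ell_1$ be the space of absolutely summable sequences, $cs$ the space of sequences whose series converges, and $bs$ the space of sequences whose series has bounded partial sums. For a sequence space $\lambda\subseteq\omega$, the alpha-, beta- and gamma-duals are $\lambda^\alpha=\{a\in\omega:(a_kx_k)\in\ell_1\text{ for all }x\in\lambda\}$, $\lambda^\beta=\{a\in\omega:(a_kx_k)\in cs\text{ for all }x\in\lambda\}$, $\lambda^\gamma=\{a\in\omega:(a_kx_k)\in bs\text{ for all }x\in\lambda\}$. *)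

theory Defs
  imports Complex_Main "HOL-Library.Extended_Nonnegative_Real" "HOL-Number_Theory.Fib"
begin

text \<open>The space \<open>\<omega>\<close> of all real sequences is the whole type \<^typ>\<open>nat \<Rightarrow> real\<close>.\<close>

type_synonym seq = "nat \<Rightarrow> real"

text \<open>
  The Fibonacci numbers are normalised by \<open>f\<^sub>0 = f\<^sub>1 = 1\<close>, whereas the library has
  \<open>fib 0 = 0\<close> and \<open>fib 1 = 1\<close>; hence the shift of the index by one.
\<close>

definition fibo :: "nat \<Rightarrow> real" where
  "fibo n = real (fib (Suc n))"

lemma fibo_0: "fibo 0 = 1"
  and fibo_1: "fibo 1 = 1"
  and fibo_rec: "n \<ge> 2 \<Longrightarrow> fibo n = fibo (n - 1) + fibo (n - 2)"
proof -
  show "fibo 0 = 1" "fibo 1 = 1"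
    by (simp_all add: fibo_def)
  assume "n \<ge> 2"
  then obtain m where "n = Suc (Suc m)"
    by (metis add_2_eq_Suc le_Suc_ex)
  then show "fibo n = fibo (n - 1) + fibo (n - 2)"
    by (simp add: fibo_def)
qed

definition Fhat :: "seq \<Rightarrow> seq" where
  "Fhat x n = (if n = 0 then x 0
     else fibo n / fibo (n + 1) * x n - fibo (n + 1) / fibo n * x (n - 1))"

definition c0_space :: "seq set" where
  "c0_space = {x. x \<longlonglongrightarrow> 0}"

definition c_space :: "seq set" where
  "c_space = {x. convergent x}"

definition l1_space :: "seq set" where
  "l1_space = {x. summable (\<lambda>k. \<bar>x k\<bar>)}"

definition cs_space :: "seq set" where
  "cs_space = {x. summable x}"

definition bs_space :: "seq set" where
  "bs_space = {x. Bseq (\<lambda>n. \<Sum>k\<le>n. x k)}"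

definition c0_Fhat :: "seq set" where
  "c0_Fhat = {x. Fhat x \<in> c0_space}"

definition c_Fhat :: "seq set" where
  "c_Fhat = {x. Fhat x \<in> c_space}"

definition alpha_dual :: "seq set \<Rightarrow> seq set" where
  "alpha_dual X = {a. \<forall>x\<in>X. (\<lambda>k. a k * x k) \<in> l1_space}"

definition beta_dual :: "seq set \<Rightarrow> seq set" where
  "beta_dual X = {a. \<forall>x\<in>X. (\<lambda>k. a k * x k) \<in> cs_space}"

definition gamma_dual :: "seq set \<Rightarrow> seq set" where
  "gamma_dual X = {a. \<forall>x\<in>X. (\<lambda>k. a k * x k) \<in> bs_space}"

text \<open>
  The suprema (and, for \<open>d1\<close>, the infinite sums) are of nonnegative terms and possibly infinite,
  so they are taken in \<^typ>\<open>ennreal\<close>.  In \<open>d1\<close> the index \<open>k\<close> ranges over all of \<open>K\<close>, with no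
  restriction to \<open>k \<le> n\<close>.
\<close>

definition d1 :: "seq set" where
  "d1 = {a. (SUP K\<in>{K :: nat set. finite K}.
     \<Sum>n. ennreal \<bar>\<Sum>k\<in>K. (fibo (n + 1))\<^sup>2 / (fibo k * fibo (k + 1)) * a n\<bar>) < \<infinity>}"

definition d2 :: "seq set" where
  "d2 = {a. (SUP n :: nat.
     ennreal (\<Sum>k=0..n. \<bar>\<Sum>j=k..n. (fibo (j + 1))\<^sup>2 / (fibo k * fibo (k + 1)) * a j\<bar>)) < \<infinity>}"

definition d3 :: "seq set" where
  "d3 = {a. \<forall>k :: nat.
     convergent (\<lambda>n. \<Sum>j=k..n. (fibo (j + 1))\<^sup>2 / (fibo k * fibo (k + 1)) * a j)}"

definition d4 :: "seq set" where
  "d4 = {a. convergent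
     (\<lambda>n. \<Sum>k=0..n. \<Sum>j=k..n. (fibo (j + 1))\<^sup>2 / (fibo k * fibo (k + 1)) * a j)}"

end

theory Submission
  imports Defs
begin

text \<open>
  All three duals reduce to conditions on the single series with terms
  \<open>b\<^sub>j = f\<^sub>j\<^sub>+\<^sub>1\<^sup>2 a\<^sub>j\<close>.
  Write \<open>w\<^sub>n = f\<^sub>n\<^sub>+\<^sub>1\<^sup>2\<close> and \<open>g\<^sub>k = 1 / (f\<^sub>k f\<^sub>k\<^sub>+\<^sub>1)\<close>.  Dividing the recurrence \<open>Fhat x = y\<close> by
  \<open>f\<^sub>n f\<^sub>n\<^sub>+\<^sub>1\<close> turns it into a telescoping one for \<open>x\<^sub>n / w\<^sub>n\<close>, so
  \<open>x\<^sub>n = w\<^sub>n (g\<^sub>0 y\<^sub>0 + \<dots> + g\<^sub>n y\<^sub>n)\<close>.  Since the Fibonacci numbers grow exponentially, \<open>g\<close> is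
  summable.  Two consequences decide everything.

  On the one hand, \<open>Fhat w\<close> is the unit sequence \<open>(1, 0, 0, \<dots>)\<close>, so \<open>w\<close> lies in both domains;
  testing a multiplier \<open>a\<close> against \<open>w\<close> alone shows that \<open>\<Sum> b\<^sub>j\<close> is absolutely convergent,
  convergent, or has bounded partial sums, according to the dual.  On the other hand, every \<open>x\<close> with
  \<open>Fhat x\<close> bounded is \<open>w\<close> times the sequence of partial sums of the absolutely convergent series
  \<open>\<Sum> g\<^sub>k y\<^sub>k\<close>.  Such a factor has bounded variation, and Abel's summation by parts
  (\<open>abel_summation\<close>) shows that it preserves each of the three properties.
  So each dual is the same for every space that contains \<open>w\<close> and on which \<open>Fhat\<close> is
  bounded (\<open>alpha_dual_eq\<close>, \<open>beta_dual_eq\<close>, \<open>gamma_dual_eq\<close>).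

  The sets \<open>d1\<close> to \<open>d4\<close> are governed by the same series.  The numbers in \<open>d1\<close> factor as
  \<open>g\<^sub>k b\<^sub>n\<close>, and those in the other sets are \<open>g\<^sub>k (b\<^sub>k + \<dots> + b\<^sub>n)\<close>.  As \<open>g\<close> is summable and
  \<open>g\<^sub>0 > 0\<close>, the column \<open>k = 0\<close> alone decides: \<open>d1\<close>, \<open>d2\<close> and \<open>d3\<close> say that
  \<open>\<Sum> b\<^sub>j\<close> converges absolutely, has bounded partial sums, and converges, respectively, and
  \<open>d3\<close> is contained in \<open>d2\<close> and in \<open>d4\<close>.  In particular the two beta-duals coincide.
\<close>

section \<open>Multiplying a series by a factor of bounded variation\<close>

lemma abel_summation:
  fixes b c :: "nat \<Rightarrow> real"
  shows "(\<Sum>j\<le>n. b j * (\<Sum>k\<le>j. c k)) =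
    (\<Sum>j\<le>n. b j) * (\<Sum>k\<le>n. c k) - (\<Sum>k\<le>n. c k * (\<Sum>j<k. b j))"
  by (induction n) (simp_all add: algebra_simps lessThan_Suc_atMost)

text \<open>
  On the right-hand side of the summation by parts, the factor \<open>\<Sum> c\<^sub>k\<close> converges and the subtracted
  series converges absolutely as soon as the partial sums of \<open>b\<close> are bounded.  Hence the partial
  sums of the product behave as well as those of \<open>b\<close> do.
\<close>

lemma bounded_partial_sums_mult:
  fixes b c :: "nat \<Rightarrow> real"
  assumes b: "Bseq (\<lambda>n. \<Sum>j\<le>n. b j)" and c: "summable (\<lambda>k. \<bar>c k\<bar>)"
  shows "Bseq (\<lambda>n. \<Sum>j\<le>n. b j * (\<Sum>k\<le>j. c k))"
    and "summable (\<lambda>k. \<bar>c k * (\<Sum>j<k. b j)\<bar>)"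
proof -
  obtain M where M: "\<And>n. norm (\<Sum>j\<le>n. b j) \<le> M"
    using b by (auto simp: Bseq_def)
  \<comment> \<open>The empty sum is not among the \<open>\<Sum>j\<le>n. b j\<close>; \<open>M \<ge> 0\<close> covers it.\<close>
  have M': "\<bar>\<Sum>j<k. b j\<bar> \<le> M" for k
    using M[of "k - 1"] M[of 0] by (cases k) (auto simp: lessThan_Suc_atMost)
  show s: "summable (\<lambda>k. \<bar>c k * (\<Sum>j<k. b j)\<bar>)"
  proof (rule summable_comparison_test')
    show "summable (\<lambda>k. \<bar>c k\<bar> * M)"
      using c by (rule summable_mult2)
    show "norm \<bar>c k * (\<Sum>j<k. b j)\<bar> \<le> \<bar>c k\<bar> * M" if "k \<ge> 0" for k
      using M'[of k] by (simp add: abs_mult mult_left_mono)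
  qed
  have conv: "convergent (\<lambda>n. \<Sum>k\<le>n. f k)" if "summable (\<lambda>k. \<bar>f k\<bar>)" for f :: "nat \<Rightarrow> real"
    using summable_rabs_cancel[OF that] by (simp add: summable_iff_convergent')
  have "Bseq (\<lambda>n. (\<Sum>j\<le>n. b j) * (\<Sum>k\<le>n. c k))"
    by (intro Bseq_mult b convergent_imp_Bseq conv c)
  then obtain K where K: "\<And>n. \<bar>(\<Sum>j\<le>n. b j) * (\<Sum>k\<le>n. c k)\<bar> \<le> K"
    by (auto simp: Bseq_def)
  obtain L where L: "\<And>n. \<bar>\<Sum>k\<le>n. c k * (\<Sum>j<k. b j)\<bar> \<le> L"
    using convergent_imp_Bseq[OF conv[OF s]] by (auto simp: Bseq_def)
  have "\<bar>\<Sum>j\<le>n. b j * (\<Sum>k\<le>j. c k)\<bar> \<le> K + L" for n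
    using K[of n] L[of n] unfolding abel_summation by linarith
  then show "Bseq (\<lambda>n. \<Sum>j\<le>n. b j * (\<Sum>k\<le>j. c k))"
    by (intro BseqI'[of _ "K + L"]) simp
qed

lemma summable_mult_partial_sums:
  fixes b c :: "nat \<Rightarrow> real"
  assumes b: "summable b" and c: "summable (\<lambda>k. \<bar>c k\<bar>)"
  shows "summable (\<lambda>j. b j * (\<Sum>k\<le>j. c k))"
proof -
  have B: "convergent (\<lambda>n. \<Sum>j\<le>n. b j)"
    using b by (simp add: summable_iff_convergent')
  have "convergent (\<lambda>n. \<Sum>k\<le>n. c k * (\<Sum>j<k. b j))"
    using bounded_partial_sums_mult(2)[OF convergent_imp_Bseq[OF B] c]
    by (metis summable_rabs_cancel summable_iff_convergent')
  moreover have "convergent (\<lambda>n. \<Sum>k\<le>n. c k)"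
    using summable_rabs_cancel[OF c] by (simp add: summable_iff_convergent')
  ultimately show ?thesis
    unfolding summable_iff_convergent' abel_summation
    using B by (intro convergent_diff convergent_mult)
qed

lemma abs_summable_mult_partial_sums:
  fixes b c :: "nat \<Rightarrow> real"
  assumes b: "summable (\<lambda>j. \<bar>b j\<bar>)" and c: "summable (\<lambda>k. \<bar>c k\<bar>)"
  shows "summable (\<lambda>j. \<bar>b j * (\<Sum>k\<le>j. c k)\<bar>)"
proof (rule summable_comparison_test')
  show "summable (\<lambda>j. \<bar>b j\<bar> * (\<Sum>k. \<bar>c k\<bar>))"
    using b by (rule summable_mult2)
  show "norm \<bar>b j * (\<Sum>k\<le>j. c k)\<bar> \<le> \<bar>b j\<bar> * (\<Sum>k. \<bar>c k\<bar>)" if "j \<ge> 0" for j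
  proof -
    have "\<bar>\<Sum>k\<le>j. c k\<bar> \<le> (\<Sum>k\<le>j. \<bar>c k\<bar>)"
      by (rule sum_abs)
    also have "\<dots> \<le> (\<Sum>k. \<bar>c k\<bar>)"
      using c by (intro sum_le_suminf) auto
    finally show ?thesis
      by (simp add: abs_mult mult_left_mono)
  qed
qed

section \<open>Inverting the Fibonacci difference operator\<close>

definition fibo_sq :: seq where
  "fibo_sq n = (fibo (n + 1))\<^sup>2"

definition fibo_gap :: seq where
  "fibo_gap k = 1 / (fibo k * fibo (k + 1))"

lemma fibo_ge_1: "fibo n \<ge> 1"
  by (simp add: fibo_def Suc_le_eq fib_neq_0_nat)

lemma fibo_pos: "fibo n > 0"
  using fibo_ge_1[of n] by simp

lemma fibo_Suc_0: "fibo (Suc 0) = 1"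
  by (simp add: fibo_def)

lemma fibo_Suc_Suc: "fibo (Suc (Suc n)) = fibo (Suc n) + fibo n"
  by (simp add: fibo_rec)

lemma fibo_gap_pos: "fibo_gap k > 0"
  by (simp add: fibo_gap_def fibo_pos)

lemma fibo_gap_0: "fibo_gap 0 = 1"
  by (simp add: fibo_gap_def fibo_0 fibo_Suc_0)

text \<open>
  The terms are dominated by telescoping differences:
  \<open>1 / f\<^sub>k - 1 / f\<^sub>k\<^sub>+\<^sub>1 = f\<^sub>k\<^sub>-\<^sub>1 / (f\<^sub>k f\<^sub>k\<^sub>+\<^sub>1)\<close>, and \<open>f\<^sub>k\<^sub>-\<^sub>1 \<ge> 1\<close>.
\<close>

lemma summable_fibo_gap: "summable fibo_gap"
proof -
  have step: "fibo_gap (Suc k) \<le> 1 / fibo (Suc k) - 1 / fibo (Suc (Suc k))" for k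
  proof -
    have "1 / fibo (Suc k) - 1 / fibo (Suc (Suc k)) = fibo k * fibo_gap (Suc k)"
      using fibo_pos[of "Suc k"] fibo_pos[of "Suc (Suc k)"]
      by (simp add: fibo_gap_def diff_divide_eq_iff divide_diff_eq_iff field_simps fibo_Suc_Suc)
    then show ?thesis
      using fibo_ge_1[of k] fibo_gap_pos[of "Suc k"] by simp
  qed
  have bound: "(\<Sum>k\<le>n. fibo_gap k) \<le> 2 - 1 / fibo (Suc n)" for n
  proof (induction n)
    case 0
    show ?case
      by (simp add: fibo_gap_0 fibo_Suc_0)
  next
    case (Suc n)
    then show ?case
      using step[of n] by simp
  qed
  have "(\<Sum>k\<le>n. fibo_gap k) \<le> 2" for n
    using bound[of n] fibo_pos[of "Suc n"] by (smt (verit) zero_le_divide_1_iff)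
  then show ?thesis
    using bounded_imp_summable[of fibo_gap 2] fibo_gap_pos less_imp_le by blast
qed

text \<open>
  Multiplication by the gap is the normalisation under which the operator becomes the plain backward
  difference of the sequence divided by \<open>fibo_sq\<close>.
\<close>

lemma fibo_gap_Fhat:
  "fibo_gap 0 * Fhat x 0 = x 0 / fibo_sq 0"
  "fibo_gap (Suc n) * Fhat x (Suc n) = x (Suc n) / fibo_sq (Suc n) - x n / fibo_sq n"
proof -
  show "fibo_gap 0 * Fhat x 0 = x 0 / fibo_sq 0"
    by (simp add: fibo_gap_0 Fhat_def fibo_sq_def fibo_Suc_0)
  show "fibo_gap (Suc n) * Fhat x (Suc n) = x (Suc n) / fibo_sq (Suc n) - x n / fibo_sq n"
    using fibo_pos[of "Suc n"] fibo_pos[of "Suc (Suc n)"]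
    by (simp add: fibo_gap_def Fhat_def fibo_sq_def right_diff_distrib power2_eq_square)
qed

lemma fibo_sq_pos: "fibo_sq n > 0"
  unfolding fibo_sq_def by (intro zero_less_power fibo_pos)

lemma Fhat_inversion: "x n = fibo_sq n * (\<Sum>k\<le>n. fibo_gap k * Fhat x k)"
proof -
  have "(\<Sum>k\<le>n. fibo_gap k * Fhat x k) = x n / fibo_sq n"
    by (induction n) (simp_all add: fibo_gap_Fhat)
  then show ?thesis
    using fibo_sq_pos[of n] by simp
qed

lemma Fhat_fibo_sq: "Fhat fibo_sq n = (if n = 0 then 1 else 0)"
proof (cases n)
  case 0
  then show ?thesis
    by (simp add: Fhat_def fibo_sq_def fibo_Suc_0)
next
  case (Suc m)
  have "fibo_gap n * Fhat fibo_sq n = 0"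
    using fibo_sq_pos[of m] fibo_sq_pos[of n] by (simp add: Suc fibo_gap_Fhat)
  then show ?thesis
    using fibo_gap_pos[of n] Suc by simp
qed

lemma summable_fibo_gap_mult:
  assumes "Bseq y"
  shows "summable (\<lambda>k. \<bar>fibo_gap k * y k\<bar>)"
proof -
  obtain M where M: "\<And>k. norm (y k) \<le> M"
    using assms by (auto simp: Bseq_def)
  show ?thesis
  proof (rule summable_comparison_test')
    show "summable (\<lambda>k. fibo_gap k * M)"
      by (intro summable_mult2 summable_fibo_gap)
    show "norm \<bar>fibo_gap k * y k\<bar> \<le> fibo_gap k * M" if "k \<ge> 0" for k
      using M[of k] fibo_gap_pos[of k] by (simp add: abs_mult mult_left_mono)
  qed
qed

section \<open>The duals of a space on which the transform is bounded\<close>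

lemma mult_seq_eq:
  "(\<lambda>j. a j * x j) = (\<lambda>j. fibo_sq j * a j * (\<Sum>k\<le>j. fibo_gap k * Fhat x k))"
proof
  show "a j * x j = fibo_sq j * a j * (\<Sum>k\<le>j. fibo_gap k * Fhat x k)" for j
    by (subst Fhat_inversion[of x j]) (simp add: mult_ac)
qed

text \<open>
  In each of the three proofs below, \<open>fibo_sq\<close> as the only test sequence gives the necessary condition;
  boundedness of the transform makes the correction factor of every other sequence in \<open>X\<close> a sequence
  of partial sums of an absolutely convergent series, which gives sufficiency.
\<close>

context
  fixes X :: "seq set"
  assumes fibo_sq_mem: "fibo_sq \<in> X" and Fhat_bounded: "\<And>x. x \<in> X \<Longrightarrow> Bseq (Fhat x)"
begin

lemma alpha_dual_eq: "alpha_dual X = {a. summable (\<lambda>j. \<bar>fibo_sq j * a j\<bar>)}"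
proof (intro Set.equalityI subsetI CollectI)
  fix a assume "a \<in> alpha_dual X"
  then have "(\<lambda>j. a j * fibo_sq j) \<in> l1_space"
    using fibo_sq_mem by (auto simp: alpha_dual_def)
  then show "summable (\<lambda>j. \<bar>fibo_sq j * a j\<bar>)"
    by (simp add: l1_space_def mult.commute)
next
  fix a assume "a \<in> {a. summable (\<lambda>j. \<bar>fibo_sq j * a j\<bar>)}"
  then have a: "summable (\<lambda>j. \<bar>fibo_sq j * a j\<bar>)"
    by simp
  have "(\<lambda>j. a j * x j) \<in> l1_space" if "x \<in> X" for x
    using abs_summable_mult_partial_sums[OF a summable_fibo_gap_mult[OF Fhat_bounded[OF that]]]
    unfolding mult_seq_eq[of a x] l1_space_def by simp
  then show "a \<in> alpha_dual X"
    by (simp add: alpha_dual_def)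
qed

lemma beta_dual_eq: "beta_dual X = {a. summable (\<lambda>j. fibo_sq j * a j)}"
proof (intro Set.equalityI subsetI CollectI)
  fix a assume "a \<in> beta_dual X"
  then have "(\<lambda>j. a j * fibo_sq j) \<in> cs_space"
    using fibo_sq_mem by (auto simp: beta_dual_def)
  then show "summable (\<lambda>j. fibo_sq j * a j)"
    by (simp add: cs_space_def mult.commute)
next
  fix a assume "a \<in> {a. summable (\<lambda>j. fibo_sq j * a j)}"
  then have a: "summable (\<lambda>j. fibo_sq j * a j)"
    by simp
  have "(\<lambda>j. a j * x j) \<in> cs_space" if "x \<in> X" for x
    using summable_mult_partial_sums[OF a summable_fibo_gap_mult[OF Fhat_bounded[OF that]]]
    unfolding mult_seq_eq[of a x] cs_space_def by simp
  then show "a \<in> beta_dual X"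
    by (simp add: beta_dual_def)
qed

lemma gamma_dual_eq: "gamma_dual X = {a. Bseq (\<lambda>n. \<Sum>j\<le>n. fibo_sq j * a j)}"
proof (intro Set.equalityI subsetI CollectI)
  fix a assume "a \<in> gamma_dual X"
  then have "(\<lambda>j. a j * fibo_sq j) \<in> bs_space"
    using fibo_sq_mem by (auto simp: gamma_dual_def)
  then show "Bseq (\<lambda>n. \<Sum>j\<le>n. fibo_sq j * a j)"
    by (simp add: bs_space_def mult.commute)
next
  fix a assume "a \<in> {a. Bseq (\<lambda>n. \<Sum>j\<le>n. fibo_sq j * a j)}"
  then have a: "Bseq (\<lambda>n. \<Sum>j\<le>n. fibo_sq j * a j)"
    by simp
  have "(\<lambda>j. a j * x j) \<in> bs_space" if "x \<in> X" for x
    using bounded_partial_sums_mult(1)[OF a summable_fibo_gap_mult[OF Fhat_bounded[OF that]]]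
    unfolding mult_seq_eq[of a x] bs_space_def by simp
  then show "a \<in> gamma_dual X"
    by (simp add: gamma_dual_def)
qed

end

lemma fibo_sq_in_c0_Fhat: "fibo_sq \<in> c0_Fhat"
proof -
  have "Fhat fibo_sq \<longlonglongrightarrow> 0"
    by (rule tendsto_eventually) (auto simp: Fhat_fibo_sq eventually_sequentially intro: exI[of _ 1])
  then show ?thesis
    by (simp add: c0_Fhat_def c0_space_def)
qed

lemma c0_Fhat_subset_c_Fhat: "c0_Fhat \<subseteq> c_Fhat"
  by (auto simp: c0_Fhat_def c0_space_def c_Fhat_def c_space_def convergent_def)

lemma Bseq_Fhat: "x \<in> c_Fhat \<Longrightarrow> Bseq (Fhat x)"
  by (simp add: c_Fhat_def c_space_def convergent_imp_Bseq)

section \<open>The sets that describe the duals\<close>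

text \<open>
  Here the sum over \<open>K\<close> separates from the sum over \<open>n\<close>; summability of the gaps bounds the first
  factor uniformly in \<open>K\<close>, and \<open>K = {0}\<close> shows that the second factor has to be finite.
\<close>

lemma d1_eq: "d1 = {a. summable (\<lambda>j. \<bar>fibo_sq j * a j\<bar>)}"
proof -
  have inner: "\<bar>\<Sum>k\<in>K. (fibo (n + 1))\<^sup>2 / (fibo k * fibo (k + 1)) * a n\<bar>
      = (\<Sum>k\<in>K. fibo_gap k) * \<bar>fibo_sq n * a n\<bar>" for K n and a :: seq
  proof -
    have "(\<Sum>k\<in>K. (fibo (n + 1))\<^sup>2 / (fibo k * fibo (k + 1)) * a n)
        = (\<Sum>k\<in>K. fibo_gap k) * (fibo_sq n * a n)"
      by (simp add: sum_distrib_right fibo_gap_def fibo_sq_def)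
    then show ?thesis
      using fibo_gap_pos by (simp add: abs_mult sum_nonneg less_imp_le)
  qed
  let ?S = "\<lambda>a :: seq. \<lambda>K. \<Sum>n. ennreal ((\<Sum>k\<in>K. fibo_gap k) * \<bar>fibo_sq n * a n\<bar>)"
  have "(SUP K\<in>{K. finite K}. ?S a K) < \<infinity> \<longleftrightarrow> summable (\<lambda>j. \<bar>fibo_sq j * a j\<bar>)" for a
  proof
    assume "(SUP K\<in>{K. finite K}. ?S a K) < \<infinity>"
    moreover have "?S a {0} \<le> (SUP K\<in>{K. finite K}. ?S a K)"
      by (rule SUP_upper) simp
    ultimately have "(\<Sum>n. ennreal \<bar>fibo_sq n * a n\<bar>) \<noteq> top"
      by (auto simp: fibo_gap_0 top_unique)
    then show "summable (\<lambda>j. \<bar>fibo_sq j * a j\<bar>)"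
      by (intro summable_suminf_not_top) auto
  next
    assume sum: "summable (\<lambda>j. \<bar>fibo_sq j * a j\<bar>)"
    let ?c = "suminf fibo_gap"
    have "?S a K \<le> ennreal (\<Sum>n. ?c * \<bar>fibo_sq n * a n\<bar>)" if "finite K" for K
    proof -
      have G: "(\<Sum>k\<in>K. fibo_gap k) \<le> ?c"
        using that summable_fibo_gap fibo_gap_pos by (intro sum_le_suminf) (auto intro: less_imp_le)
      then have c: "0 \<le> ?c"
        using fibo_gap_pos summable_fibo_gap by (intro suminf_nonneg) (auto intro: less_imp_le)
      have "?S a K \<le> (\<Sum>n. ennreal (?c * \<bar>fibo_sq n * a n\<bar>))"
        using G by (intro suminf_le) (auto intro!: ennreal_leI mult_right_mono)
      also have "\<dots> = ennreal (\<Sum>n. ?c * \<bar>fibo_sq n * a n\<bar>)"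
        using c sum by (intro suminf_ennreal2 summable_mult) auto
      finally show ?thesis .
    qed
    then have "(SUP K\<in>{K. finite K}. ?S a K) \<le> ennreal (\<Sum>n. ?c * \<bar>fibo_sq n * a n\<bar>)"
      by (intro SUP_least) auto
    then show "(SUP K\<in>{K. finite K}. ?S a K) < \<infinity>"
      by (simp add: le_less_trans)
  qed
  then show ?thesis
    unfolding d1_def inner by blast
qed

text \<open>
  Splitting off the initial segment \<open>j < k\<close> leaves, for fixed \<open>k\<close>, only the dependence on \<open>n\<close>
  through one partial sum.  For \<open>k = 0\<close> the entry is that partial sum itself.
\<close>

lemma dual_matrix_entry:
  assumes "k \<le> n"
  shows "(\<Sum>j=k..n. (fibo (j + 1))\<^sup>2 / (fibo k * fibo (k + 1)) * a j)
    = fibo_gap k * ((\<Sum>j\<le>n. fibo_sq j * a j) - (\<Sum>j<k. fibo_sq j * a j))"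
proof -
  have "(\<Sum>j\<le>n. fibo_sq j * a j) = (\<Sum>j<k. fibo_sq j * a j) + (\<Sum>j=k..n. fibo_sq j * a j)"
  proof -
    have "{..n} = {..<k} \<union> {k..n}"
      using assms by auto
    then show ?thesis
      by (simp add: sum.union_disjoint disjoint_iff)
  qed
  then show ?thesis
    by (simp add: sum_distrib_left fibo_gap_def fibo_sq_def)
qed

text \<open>
  The term \<open>k = 0\<close> of the \<open>n\<close>-th row is the \<open>n\<close>-th partial sum, so a bound on the rows bounds the
  partial sums.  Conversely, if \<open>M\<close> bounds the partial sums, then the \<open>k\<close>-th entry is at most
  \<open>2 M\<close> times the \<open>k\<close>-th gap, and the gaps are summable.
\<close>

lemma d2_eq: "d2 = {a. Bseq (\<lambda>n. \<Sum>j\<le>n. fibo_sq j * a j)}"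
proof -
  let ?T = "\<lambda>a :: seq. \<lambda>n k. \<Sum>j=k..n. (fibo (j + 1))\<^sup>2 / (fibo k * fibo (k + 1)) * a j"
  have "(SUP n. ennreal (\<Sum>k=0..n. \<bar>?T a n k\<bar>)) < \<infinity> \<longleftrightarrow> Bseq (\<lambda>n. \<Sum>j\<le>n. fibo_sq j * a j)" for a
  proof
    assume "(SUP n. ennreal (\<Sum>k=0..n. \<bar>?T a n k\<bar>)) < \<infinity>"
    then obtain M where M: "(SUP n. ennreal (\<Sum>k=0..n. \<bar>?T a n k\<bar>)) = ennreal M" "M \<ge> 0"
      unfolding infinity_ennreal_def less_top_ennreal by blast
    have "\<bar>\<Sum>j\<le>n. fibo_sq j * a j\<bar> \<le> M" for n
    proof -
      have "\<bar>\<Sum>j\<le>n. fibo_sq j * a j\<bar> = \<bar>?T a n 0\<bar>"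
        unfolding dual_matrix_entry[OF le0] by (simp add: fibo_gap_0)
      also have "\<dots> \<le> (\<Sum>k=0..n. \<bar>?T a n k\<bar>)"
        by (rule member_le_sum) auto
      also have "\<dots> \<le> M"
        using M SUP_upper[of n UNIV "\<lambda>n. ennreal (\<Sum>k=0..n. \<bar>?T a n k\<bar>)"] by simp
      finally show ?thesis .
    qed
    then show "Bseq (\<lambda>n. \<Sum>j\<le>n. fibo_sq j * a j)"
      by (intro BseqI'[of _ M]) simp
  next
    assume "Bseq (\<lambda>n. \<Sum>j\<le>n. fibo_sq j * a j)"
    then obtain M where M: "\<And>n. \<bar>\<Sum>j\<le>n. fibo_sq j * a j\<bar> \<le> M"
      by (auto simp: Bseq_def)
    have M': "\<bar>\<Sum>j<k. fibo_sq j * a j\<bar> \<le> M" for k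
      using M[of "k - 1"] M[of 0] by (cases k) (auto simp: lessThan_Suc_atMost)
    have "(\<Sum>k=0..n. \<bar>?T a n k\<bar>) \<le> suminf fibo_gap * (2 * M)" for n
    proof -
      have "\<bar>?T a n k\<bar> \<le> fibo_gap k * (2 * M)" if "k \<le> n" for k
      proof -
        have "\<bar>(\<Sum>j\<le>n. fibo_sq j * a j) - (\<Sum>j<k. fibo_sq j * a j)\<bar> \<le> 2 * M"
          using M[of n] M'[of k] by linarith
        then show ?thesis
          using fibo_gap_pos[of k] unfolding dual_matrix_entry[OF that]
          by (simp add: abs_mult)
      qed
      then have "(\<Sum>k=0..n. \<bar>?T a n k\<bar>) \<le> (\<Sum>k=0..n. fibo_gap k * (2 * M))"
        by (intro sum_mono) simp
      also have "\<dots> = (\<Sum>k=0..n. fibo_gap k) * (2 * M)"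
        by (rule sum_distrib_right[symmetric])
      also have "\<dots> \<le> suminf fibo_gap * (2 * M)"
        using M[of 0] summable_fibo_gap fibo_gap_pos
        by (intro mult_right_mono sum_le_suminf) (auto intro: less_imp_le)
      finally show ?thesis .
    qed
    then have "(SUP n. ennreal (\<Sum>k=0..n. \<bar>?T a n k\<bar>)) \<le> ennreal (suminf fibo_gap * (2 * M))"
      by (intro SUP_least ennreal_leI)
    then show "(SUP n. ennreal (\<Sum>k=0..n. \<bar>?T a n k\<bar>)) < \<infinity>"
      by (simp add: le_less_trans)
  qed
  then show ?thesis
    unfolding d2_def by blast
qed

lemma d3_eq: "d3 = {a. summable (\<lambda>j. fibo_sq j * a j)}"
proof (intro Set.equalityI subsetI CollectI)
  fix a assume "a \<in> d3"
  then have "convergent (\<lambda>n. \<Sum>j=0..n. (fibo (j + 1))\<^sup>2 / (fibo 0 * fibo (0 + 1)) * a j)"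
    unfolding d3_def by blast
  then show "summable (\<lambda>j. fibo_sq j * a j)"
    unfolding dual_matrix_entry[OF le0] by (simp add: fibo_gap_0 summable_iff_convergent')
next
  fix a assume "a \<in> {a. summable (\<lambda>j. fibo_sq j * a j)}"
  then have B: "convergent (\<lambda>n. \<Sum>j\<le>n. fibo_sq j * a j)"
    by (simp add: summable_iff_convergent')
  have "convergent (\<lambda>n. \<Sum>j=k..n. (fibo (j + 1))\<^sup>2 / (fibo k * fibo (k + 1)) * a j)" for k
  proof -
    have "convergent (\<lambda>n. fibo_gap k * ((\<Sum>j\<le>n. fibo_sq j * a j) - (\<Sum>j<k. fibo_sq j * a j)))"
      using B by (intro convergent_mult convergent_diff convergent_const)
    moreover have "\<forall>\<^sub>F n in sequentially.
        (\<Sum>j=k..n. (fibo (j + 1))\<^sup>2 / (fibo k * fibo (k + 1)) * a j)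
        = fibo_gap k * ((\<Sum>j\<le>n. fibo_sq j * a j) - (\<Sum>j<k. fibo_sq j * a j))"
      using eventually_ge_at_top[of k] by eventually_elim (rule dual_matrix_entry)
    ultimately show ?thesis
      by (simp only: convergent_cong)
  qed
  then show "a \<in> d3"
    by (simp add: d3_def)
qed

lemma d3_subset_d2: "d3 \<subseteq> d2"
  by (auto simp: d2_eq d3_eq summable_iff_convergent' convergent_imp_Bseq)

text \<open>
  Read backwards, summation by parts turns the sum of the \<open>n\<close>-th row into the \<open>n\<close>-th partial sum of
  the original series multiplied by the partial sums of the gaps.
\<close>

lemma d3_subset_d4: "d3 \<subseteq> d4"
proof
  fix a assume "a \<in> d3"
  then have "summable (\<lambda>j. fibo_sq j * a j * (\<Sum>k\<le>j. fibo_gap k))"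
    using summable_fibo_gap fibo_gap_pos
    by (intro summable_mult_partial_sums) (simp_all add: d3_eq less_imp_le)
  moreover have "(\<Sum>k=0..n. \<Sum>j=k..n. (fibo (j + 1))\<^sup>2 / (fibo k * fibo (k + 1)) * a j)
      = (\<Sum>j\<le>n. fibo_sq j * a j * (\<Sum>k\<le>j. fibo_gap k))" for n
  proof -
    have "(\<Sum>k=0..n. \<Sum>j=k..n. (fibo (j + 1))\<^sup>2 / (fibo k * fibo (k + 1)) * a j)
        = (\<Sum>k\<le>n. fibo_gap k * ((\<Sum>j\<le>n. fibo_sq j * a j) - (\<Sum>j<k. fibo_sq j * a j)))"
      by (intro sum.cong) (simp_all only: atMost_atLeast0 atLeastAtMost_iff dual_matrix_entry)
    also have "\<dots> = (\<Sum>j\<le>n. fibo_sq j * a j) * (\<Sum>k\<le>n. fibo_gap k)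
        - (\<Sum>k\<le>n. fibo_gap k * (\<Sum>j<k. fibo_sq j * a j))"
      by (subst mult.commute[of "\<Sum>j\<le>n. fibo_sq j * a j"])
        (simp only: right_diff_distrib sum_subtractf sum_distrib_right)
    also have "\<dots> = (\<Sum>j\<le>n. fibo_sq j * a j * (\<Sum>k\<le>j. fibo_gap k))"
      by (rule abel_summation[symmetric])
    finally show ?thesis .
  qed
  ultimately show "a \<in> d4"
    unfolding d4_def by (simp add: summable_iff_convergent')
qed

section \<open>The dual spaces\<close>

theorem corollary4p3:
  shows "(alpha_dual c0_Fhat = d1 \<and> alpha_dual c_Fhat = d1)
    \<and> (beta_dual c0_Fhat = d2 \<inter> d3 \<and> beta_dual c_Fhat = d2 \<inter> d3 \<inter> d4)
    \<and> (gamma_dual c0_Fhat = d2 \<and> gamma_dual c_Fhat = d2)"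
proof -
  have mem: "fibo_sq \<in> c0_Fhat" "fibo_sq \<in> c_Fhat"
    using fibo_sq_in_c0_Fhat c0_Fhat_subset_c_Fhat by auto
  have bdd: "\<And>x. x \<in> c0_Fhat \<Longrightarrow> Bseq (Fhat x)" "\<And>x. x \<in> c_Fhat \<Longrightarrow> Bseq (Fhat x)"
    using Bseq_Fhat c0_Fhat_subset_c_Fhat by auto
  have "d2 \<inter> d3 = d3" "d2 \<inter> d3 \<inter> d4 = d3"
    using d3_subset_d2 d3_subset_d4 by auto
  then show ?thesis
    using alpha_dual_eq[OF mem(1) bdd(1)] alpha_dual_eq[OF mem(2) bdd(2)]
      beta_dual_eq[OF mem(1) bdd(1)] beta_dual_eq[OF mem(2) bdd(2)]
      gamma_dual_eq[OF mem(1) bdd(1)] gamma_dual_eq[OF mem(2) bdd(2)]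
    by (simp add: d1_eq d2_eq d3_eq)
qed

end
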